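(* Fix constants $\epsilon,\tau>0$ independent of $n$ and let $a>0$. Place $n$ sensors on $[0,\infty)$ at the first $n$ arrival times $X_1\le\dots\le X_n$ of a homogeneous Poisson process on $[0,\infty)$ with rate $n$. Let $s=\frac{1-\epsilon}{n}$, $v=\frac{1+\tau}{n}$ and consider algorithm $I_1(n,s,v)$: for $i=2,\dots,n$ in turn, with $X_{i-1}$ denoting the current (possibly already moved) position of sensor $i-1$, if $X_i-X_{i-1}<s$ move sensor $i$ to $X_{i-1}+s$; if $X_i-X_{i-1}>v$ move sensor $i$ to $X_{i-1}+v$; otherwise leave it in place. Then the expected $a$-total movement of this algorithm is $O\!\left(n^{1-a}\right)$.
   Context: If the $i$-th sensor is displaced by a distance $|m(i)|$, the $a$-total movement is $\sum_{i=1}^n|m(i)|^a$. The output of $I_1$ satisfies $s\le X_i-X_{i-1}\le v$ for all consecutive sensors. Asymptotics are as $n\to\infty$ with $a,\epsilon,\tau$ fixed. *)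

theory Defs
  imports "HOL-Probability.Probability"
begin

(* X k is the k-th arrival time; X 0 = 0 is the time origin, not an arrival. *)
definition poisson_arrival_times :: "'b measure \<Rightarrow> real \<Rightarrow> (nat \<Rightarrow> 'b \<Rightarrow> real) \<Rightarrow> bool" where
  "poisson_arrival_times M rate X \<longleftrightarrow>
     (\<forall>\<omega>\<in>space M. X 0 \<omega> = 0) \<and>
     prob_space.indep_vars M (\<lambda>_. borel) (\<lambda>k \<omega>. X (Suc k) \<omega> - X k \<omega>) UNIV \<and>
     (\<forall>k. distributed M lborel (\<lambda>\<omega>. X (Suc k) \<omega> - X k \<omega>)
            (\<lambda>x. ennreal (exponential_density rate x)))"

(* A configuration maps the sensor index i in {1..n} to its position; other indices are never
   read or changed.  In move_sensor, x (i - 1) is the current position of sensor i - 1. *)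
definition move_sensor :: "real \<Rightarrow> real \<Rightarrow> nat \<Rightarrow> (nat \<Rightarrow> real) \<Rightarrow> (nat \<Rightarrow> real)" where
  "move_sensor s v i x =
     (if x i - x (i - 1) < s then x(i := x (i - 1) + s)
      else if x i - x (i - 1) > v then x(i := x (i - 1) + v)
      else x)"

definition algorithm_I1 :: "nat \<Rightarrow> real \<Rightarrow> real \<Rightarrow> (nat \<Rightarrow> real) \<Rightarrow> (nat \<Rightarrow> real)" where
  "algorithm_I1 n s v x = fold (move_sensor s v) [2..<Suc n] x"

definition total_movement :: "real \<Rightarrow> nat \<Rightarrow> (nat \<Rightarrow> real) \<Rightarrow> (nat \<Rightarrow> real) \<Rightarrow> real" where
  "total_movement a n x y = (\<Sum>i=1..n. \<bar>y i - x i\<bar> powr a)"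

definition I1_movement :: "real \<Rightarrow> nat \<Rightarrow> real \<Rightarrow> real \<Rightarrow> (nat \<Rightarrow> real) \<Rightarrow> real" where
  "I1_movement a n s v x = total_movement a n x (algorithm_I1 n s v x)"

end

theory Submission
  imports Defs
begin

text \<open>
  Let \<open>D i\<close> be the signed displacement of sensor \<open>i\<close> and \<open>E i\<close> the \<open>i\<close>-th interarrival time. The
  algorithm gives \<open>D (i + 1) = clamp (E i - D i) - (E i - D i)\<close> with the clamp onto \<open>[s, v]\<close>, so the
  positive and the negative part of \<open>D\<close> are dominated by Lindley recursions
  \<open>p (i + 1) \<le> max 0 (p i + \<xi> i)\<close> with increments \<open>s - E i\<close> and \<open>E i - v\<close>, both of negative mean.
  Unrolling the recursion for \<open>exp (\<theta> * p i)\<close> gives a sum of products of the independent factors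
  \<open>exp (\<theta> * \<xi> k)\<close>. With \<open>\<theta> = t * n\<close> and small \<open>t\<close> each factor has a mean below 1 that
  does not depend on \<open>n\<close>, so \<open>exp (t * n * \<bar>D i\<bar>)\<close> has mean \<open>O(1)\<close> uniformly in \<open>i\<close> and
  \<open>n\<close>, and each sensor contributes \<open>O(n powr - a)\<close>.
\<close>

section \<open>Displacements\<close>

lemma algorithm_I1_Suc:
  "n \<ge> 1 \<Longrightarrow> algorithm_I1 (Suc n) s v x = move_sensor s v (Suc n) (algorithm_I1 n s v x)"
  by (simp add: algorithm_I1_def)

lemma algorithm_I1_unmoved:
  assumes "n \<ge> 1" "i > n"
  shows "algorithm_I1 n s v x i = x i"
  using assms
proof (induction n rule: dec_induct)
  case base
  then show ?case by (simp add: algorithm_I1_def)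
next
  case (step n)
  then show ?case by (auto simp: algorithm_I1_Suc move_sensor_def)
qed

text \<open>Sensor \<open>i\<close> is written only in its own round; later rounds change larger
  indices.\<close>

lemma algorithm_I1_stable:
  assumes "1 \<le> i" "i \<le> n"
  shows "algorithm_I1 n s v x i = algorithm_I1 i s v x i"
  using assms(2,1)
proof (induction n rule: dec_induct)
  case (step n)
  then show ?case by (auto simp: algorithm_I1_Suc move_sensor_def)
qed simp

text \<open>Stopping after round \<open>i\<close> makes the displacement independent of the total
  number of sensors, so it obeys a recursion in \<open>i\<close>.\<close>

definition displacement :: "real \<Rightarrow> real \<Rightarrow> (nat \<Rightarrow> real) \<Rightarrow> nat \<Rightarrow> real" where
  "displacement s v x i = algorithm_I1 i s v x i - x i"

lemma I1_movement_eq_displacement: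
  "I1_movement a n s v x = (\<Sum>i=1..n. \<bar>displacement s v x i\<bar> powr a)"
  unfolding I1_movement_def total_movement_def displacement_def
  by (intro sum.cong refl) (metis algorithm_I1_stable atLeastAtMost_iff)

lemma displacement_1: "displacement s v x (Suc 0) = 0"
  by (simp add: displacement_def algorithm_I1_def)

text \<open>Sensor \<open>Suc i\<close> is still at its original place when its round begins, so the
  gap seen is the original gap minus the displacement of sensor \<open>i\<close>. The move clamps
  this gap to \<open>[s, v]\<close>.\<close>

lemma displacement_Suc:
  assumes "i \<ge> 1" "s \<le> v"
  shows "displacement s v x (Suc i) =
    max s (min v (x (Suc i) - x i - displacement s v x i)) - (x (Suc i) - x i - displacement s v x i)"
  using assms by (auto simp: displacement_def algorithm_I1_Suc move_sensor_def algorithm_I1_unmoved)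

text \<open>A move to the right happens only when the gap seen is below \<open>s\<close>, and then
  the new displacement is the old one plus \<open>s\<close> minus the original gap. Passing to the
  positive part of the old one only enlarges this.\<close>

lemma displacement_Suc_pos_part:
  assumes "i \<ge> 1" "s \<le> v"
  shows "max 0 (displacement s v x (Suc i)) \<le>
    max 0 (max 0 (displacement s v x i) + (s - (x (Suc i) - x i)))"
  using displacement_Suc[OF assms, of x] assms by (auto simp: max_def min_def split: if_splits)

lemma displacement_Suc_neg_part:
  assumes "i \<ge> 1" "s \<le> v"
  shows "max 0 (- displacement s v x (Suc i)) \<le>
    max 0 (max 0 (- displacement s v x i) + (x (Suc i) - x i - v))"
  using displacement_Suc[OF assms, of x] assms by (auto simp: max_def min_def split: if_splits)

lemma exp_lindley_le:
  fixes p \<xi> :: "nat \<Rightarrow> real"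
  assumes "\<theta> \<ge> 0" "p 1 \<le> 0" "\<And>k. k \<ge> 1 \<Longrightarrow> p (Suc k) \<le> max 0 (p k + \<xi> k)" "i \<ge> 1"
  shows "exp (\<theta> * p i) \<le> (\<Sum>j=1..i. \<Prod>k=j..<i. exp (\<theta> * \<xi> k))"
  using assms(4)
proof (induction i rule: dec_induct)
  case base
  then show ?case using assms(1,2) by (simp add: mult_nonneg_nonpos)
next
  case (step i)
  have "exp (\<theta> * p (Suc i)) \<le> exp (\<theta> * max 0 (p i + \<xi> i))"
    using assms(1) assms(3)[OF step(1)] by (simp add: mult_left_mono)
  \<comment> \<open>The exponential of a maximum is at most the sum of the exponentials; the 1
    accounts for a restart at 0.\<close>
  also have "\<dots> \<le> exp (\<theta> * p i) * exp (\<theta> * \<xi> i) + 1"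
    by (auto simp: max_def distrib_left exp_add)
  also have "\<dots> \<le> (\<Sum>j=1..i. \<Prod>k=j..<i. exp (\<theta> * \<xi> k)) * exp (\<theta> * \<xi> i) + 1"
    using step.IH by simp
  \<comment> \<open>The added 1 is the empty product for \<open>j = Suc i\<close>.\<close>
  also have "\<dots> = (\<Sum>j=1..Suc i. \<Prod>k=j..<Suc i. exp (\<theta> * \<xi> k))"
    by (simp add: sum_distrib_right prod.atLeastLessThan_Suc)
  finally show ?case .
qed

section \<open>Exponential moments\<close>

text \<open>Exponential tilting: weighting the density of rate \<open>l\<close> by
  \<open>exp (c * x)\<close> gives \<open>l / (l - c)\<close> times the density of rate
  \<open>l - c\<close>. Negative \<open>c\<close> is allowed.\<close>

lemma exponential_moment_generating:
  assumes D: "distributed M lborel Y (\<lambda>x. ennreal (exponential_density l x))"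
    and "l > 0" "c < l"
  shows "has_bochner_integral M (\<lambda>\<omega>. exp (c * Y \<omega>)) (l / (l - c))"
proof (rule has_bochner_integral_nn_integral)
  have [measurable]: "Y \<in> borel_measurable M"
    using distributed_measurable[OF D] by simp
  show "(\<lambda>\<omega>. exp (c * Y \<omega>)) \<in> borel_measurable M" by measurable
  have "(\<integral>\<^sup>+\<omega>. ennreal (exp (c * Y \<omega>)) \<partial>M) =
      (\<integral>\<^sup>+x. ennreal (exponential_density l x) * ennreal (exp (c * x)) \<partial>lborel)"
    by (rule distributed_nn_integral[OF D, symmetric]) simp
  also have "\<dots> = (\<integral>\<^sup>+x. ennreal (l / (l - c)) * ennreal (exponential_density (l - c) x) \<partial>lborel)"
    using assms(2,3)
    by (intro nn_integral_cong)
       (auto simp: exponential_density_def ennreal_mult[symmetric] exp_add[symmetric] field_simps)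
  also have "\<dots> = ennreal (l / (l - c))"
    using nn_integral_erlang_ith_moment[of "l - c" 0 0] assms(3)
    by (simp add: nn_integral_cmult)
  finally show "(\<integral>\<^sup>+\<omega>. ennreal (exp (c * Y \<omega>)) \<partial>M) = ennreal (l / (l - c))" .
qed (use assms in auto)

text \<open>By independence each product has mean \<open>\<rho> ^ (i - j)\<close>, so a geometric
  series bounds the sum uniformly in \<open>i\<close>.\<close>

lemma (in prob_space) expectation_sum_prod_le:
  fixes Z :: "nat \<Rightarrow> 'a \<Rightarrow> real"
  assumes indep: "indep_vars (\<lambda>_. borel) Z UNIV"
    and Z: "\<And>k. has_bochner_integral M (Z k) \<rho>" and \<rho>: "0 \<le> \<rho>" "\<rho> < 1"
  shows "integrable M (\<lambda>\<omega>. \<Sum>j=1..i. \<Prod>k=j..<i. Z k \<omega>)"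
    and "expectation (\<lambda>\<omega>. \<Sum>j=1..i. \<Prod>k=j..<i. Z k \<omega>) \<le> 1 / (1 - \<rho>)"
proof -
  have ind: "indep_vars (\<lambda>_. borel) Z J" for J
    using indep by (rule indep_vars_subset) simp
  have int: "integrable M (Z k)" and ex: "expectation (Z k) = \<rho>" for k
    using Z[of k] by (auto simp: has_bochner_integral_iff)
  have intp: "integrable M (\<lambda>\<omega>. \<Prod>k=j..<i. Z k \<omega>)" for j
    by (intro indep_vars_integrable ind int) simp
  then show "integrable M (\<lambda>\<omega>. \<Sum>j=1..i. \<Prod>k=j..<i. Z k \<omega>)" by simp
  have "expectation (\<lambda>\<omega>. \<Prod>k=j..<i. Z k \<omega>) = \<rho> ^ (i - j)" for j
    by (subst indep_vars_lebesgue_integral[OF _ ind int]) (simp_all add: ex)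
  then have "expectation (\<lambda>\<omega>. \<Sum>j=1..i. \<Prod>k=j..<i. Z k \<omega>) = (\<Sum>j=1..i. \<rho> ^ (i - j))"
    using intp by simp
  also have "\<dots> = (\<Sum>m<i. \<rho> ^ m)"
    by (rule sum.reindex_bij_witness[of _ "\<lambda>m. i - m" "\<lambda>j. i - j"]) auto
  also have "\<dots> \<le> (\<Sum>m. \<rho> ^ m)"
    using \<rho> by (intro sum_le_suminf summable_geometric) auto
  also have "\<dots> = 1 / (1 - \<rho>)"
    using \<rho> by (intro suminf_geometric) simp
  finally show "expectation (\<lambda>\<omega>. \<Sum>j=1..i. \<Prod>k=j..<i. Z k \<omega>) \<le> 1 / (1 - \<rho>)" .
qed

text \<open>Raise \<open>y \<le> exp y\<close> at \<open>y = t * u / a\<close> to the power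
  \<open>a\<close>.\<close>

lemma powr_le_exp:
  fixes u a t :: real
  assumes "u \<ge> 0" "a > 0" "t > 0"
  shows "u powr a \<le> (a / t) powr a * exp (t * u)"
proof -
  have "t * u / a \<le> exp (t * u / a)"
    using exp_ge_add_one_self[of "t * u / a"] by linarith
  then have "(t * u / a) powr a \<le> exp (t * u / a) powr a"
    using assms by (intro powr_mono2) auto
  also have "\<dots> = exp (t * u)"
    using assms by (simp add: powr_def)
  finally have "(a / t) powr a * (t * u / a) powr a \<le> (a / t) powr a * exp (t * u)"
    by (intro mult_left_mono) auto
  moreover have "(a / t) powr a * (t * u / a) powr a = u powr a"
    using assms by (subst powr_mult[symmetric]) auto
  ultimately show ?thesis by simp
qed

text \<open>Both ratios equal 1 at \<open>t = 0\<close>, where their logarithms have slopes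
  \<open>- \<epsilon>\<close> and \<open>- \<tau>\<close>.\<close>

lemma exists_contracting_exponent:
  fixes \<epsilon> \<tau> :: real
  assumes "\<epsilon> > 0" "\<tau> > 0"
  obtains t where "0 < t" "t < 1" "exp (t * (1 - \<epsilon>)) / (1 + t) < 1" "exp (- t * (1 + \<tau>)) / (1 - t) < 1"
proof -
  \<comment> \<open>The bound 1/2 is the range of the quadratic lower bound for
    \<open>ln (1 - t)\<close>; the other two make the quadratic errors \<open>t\<^sup>2\<close> and
    \<open>2 * t\<^sup>2\<close> smaller than the gains \<open>t * \<epsilon>\<close> and
    \<open>t * \<tau>\<close>.\<close>
  define t where "t = Min {1/2, \<epsilon>/2, \<tau>/4}"
  have t: "0 < t" "t \<le> 1/2" "t \<le> \<epsilon>/2" "t \<le> \<tau>/4"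
    using assms by (auto simp: t_def)
  have "t * t < t * \<epsilon>"
    using t assms by (intro mult_strict_left_mono) auto
  then have "t * (1 - \<epsilon>) < t - t\<^sup>2"
    by (simp only: right_diff_distrib power2_eq_square)
  also have "\<dots> \<le> ln (1 + t)"
    using t by (intro ln_one_plus_pos_lower_bound) auto
  finally have "t * (1 - \<epsilon>) < ln (1 + t)" .
  then have pos: "exp (t * (1 - \<epsilon>)) < exp (ln (1 + t))" by (simp only: exp_less_mono)
  have "t * (2 * t) < t * \<tau>"
    using t assms by (intro mult_strict_left_mono) auto
  then have "- t * (1 + \<tau>) < - t - 2 * t\<^sup>2"
    by (simp add: distrib_left power2_eq_square)
  also have "\<dots> \<le> ln (1 - t)"
    using t by (intro ln_one_minus_pos_lower_bound) auto
  finally have "- t * (1 + \<tau>) < ln (1 - t)" .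
  then have neg: "exp (- t * (1 + \<tau>)) < exp (ln (1 - t))" by (simp only: exp_less_mono)
  show thesis
    using t pos neg by (intro that[of t]) (auto simp: field_simps)
qed

section \<open>Expected movement\<close>

text \<open>Gaps and thresholds all scale like \<open>1 / l\<close>, so
  \<open>l * \<bar>D \<omega>\<bar>\<close> has an exponential moment bounded independently of
  \<open>i\<close> and \<open>l\<close>. Undoing the scaling yields
  \<open>l powr (- a)\<close>.\<close>

lemma (in prob_space) expectation_displacement_le:
  assumes pat: "poisson_arrival_times M l X" and l: "l > 0" and s_v: "\<epsilon> > 0" "\<tau> > 0"
    and t: "0 < t" "t < 1"
    and \<rho>: "\<rho> = exp (t * (1 - \<epsilon>)) / (1 + t)" "\<rho> < 1"
    and \<sigma>: "\<sigma> = exp (- t * (1 + \<tau>)) / (1 - t)" "\<sigma> < 1"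
    and a: "a > 0" and i: "i \<ge> 1"
  defines "D \<equiv> \<lambda>\<omega>. displacement ((1 - \<epsilon>) / l) ((1 + \<tau>) / l) (\<lambda>i. X i \<omega>) i"
  shows "integrable M (\<lambda>\<omega>. \<bar>D \<omega>\<bar> powr a)"
    and "expectation (\<lambda>\<omega>. \<bar>D \<omega>\<bar> powr a) \<le> (a / t) powr a * (1 / (1 - \<rho>) + 1 / (1 - \<sigma>)) * l powr (- a)"
proof -
  define s v where "s = (1 - \<epsilon>) / l" and "v = (1 + \<tau>) / l"
  have "s \<le> v" using s_v l by (simp add: s_def v_def divide_right_mono)
  have ind: "indep_vars (\<lambda>_. borel) (\<lambda>k \<omega>. X (Suc k) \<omega> - X k \<omega>) UNIV"
    and dist: "\<And>k. distributed M lborel (\<lambda>\<omega>. X (Suc k) \<omega> - X k \<omega>) (\<lambda>x. ennreal (exponential_density l x))"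
    and X0: "\<And>\<omega>. \<omega> \<in> space M \<Longrightarrow> X 0 \<omega> = 0"
    using pat by (auto simp: poisson_arrival_times_def)
  \<comment> \<open>\<open>R\<close> drives the moves to the right and \<open>S\<close> those to the
    left. With the exponent \<open>t * l\<close> their means are the constants \<open>\<rho>\<close>
    and \<open>\<sigma>\<close>, free of \<open>l\<close>.\<close>
  define R where "R = (\<lambda>k \<omega>. exp (t * l * (s - (X (Suc k) \<omega> - X k \<omega>))))"
  define S where "S = (\<lambda>k \<omega>. exp (t * l * (X (Suc k) \<omega> - X k \<omega> - v)))"
  have indR: "indep_vars (\<lambda>_. borel) R UNIV" and indS: "indep_vars (\<lambda>_. borel) S UNIV"
    unfolding R_def S_def
    by (rule indep_vars_compose2[OF ind, of "\<lambda>_ x. exp (t * l * (s - x))"], simp,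
        rule indep_vars_compose2[OF ind, of "\<lambda>_ x. exp (t * l * (x - v))"], simp)
  have R: "has_bochner_integral M (R k) \<rho>" for k
  proof -
    have "has_bochner_integral M
        (\<lambda>\<omega>. exp (t * (1 - \<epsilon>)) * exp (- t * l * (X (Suc k) \<omega> - X k \<omega>)))
        (exp (t * (1 - \<epsilon>)) * (l / (l - - t * l)))"
      using l t by (intro has_bochner_integral_mult_right exponential_moment_generating[OF dist])
        (auto intro: less_trans[of _ 0])
    moreover have "l - - t * l = l * (1 + t)" by (simp add: algebra_simps)
    moreover have "exp (t * (1 - \<epsilon>)) * exp (- t * l * (X (Suc k) \<omega> - X k \<omega>)) = R k \<omega>" for \<omega>
      using l by (simp add: R_def s_def exp_add[symmetric] field_simps)
    ultimately show ?thesis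
      using l by (simp add: \<rho>(1))
  qed
  have S: "has_bochner_integral M (S k) \<sigma>" for k
  proof -
    \<comment> \<open>Here the moment is taken at \<open>t * l\<close>, which lies below the rate
      because \<open>t < 1\<close>.\<close>
    have "has_bochner_integral M
        (\<lambda>\<omega>. exp (- t * (1 + \<tau>)) * exp (t * l * (X (Suc k) \<omega> - X k \<omega>)))
        (exp (- t * (1 + \<tau>)) * (l / (l - t * l)))"
      using l t by (intro has_bochner_integral_mult_right exponential_moment_generating[OF dist]) auto
    moreover have "l - t * l = l * (1 - t)" by (simp add: algebra_simps)
    moreover have "exp (- t * (1 + \<tau>)) * exp (t * l * (X (Suc k) \<omega> - X k \<omega>)) = S k \<omega>" for \<omega>
      using l by (simp add: S_def v_def exp_add[symmetric] field_simps)
    ultimately show ?thesis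
      using l by (simp add: \<sigma>(1))
  qed
  have "0 \<le> \<rho>" "0 \<le> \<sigma>" using t by (auto simp: \<rho>(1) \<sigma>(1))
  note bR = expectation_sum_prod_le[OF indR R \<open>0 \<le> \<rho>\<close> \<rho>(2), of i]
    and bS = expectation_sum_prod_le[OF indS S \<open>0 \<le> \<sigma>\<close> \<sigma>(2), of i]
  define B where "B = (\<lambda>\<omega>. (a / t) powr a * l powr (- a) *
    ((\<Sum>j=1..i. \<Prod>k=j..<i. R k \<omega>) + (\<Sum>j=1..i. \<Prod>k=j..<i. S k \<omega>)))"
  have D_eq: "D = (\<lambda>\<omega>. displacement s v (\<lambda>i. X i \<omega>) i)"
    by (simp add: D_def s_def v_def)
  have bound: "\<bar>D \<omega>\<bar> powr a \<le> B \<omega>" for \<omega>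
  proof -
    have "exp (t * l * max 0 (D \<omega>)) \<le> (\<Sum>j=1..i. \<Prod>k=j..<i. R k \<omega>)"
      unfolding D_eq R_def using t l i \<open>s \<le> v\<close>
      by (intro exp_lindley_le[where p = "\<lambda>i. max 0 (displacement s v (\<lambda>i. X i \<omega>) i)"]
          displacement_Suc_pos_part) (auto simp: displacement_1)
    moreover have "exp (t * l * max 0 (- D \<omega>)) \<le> (\<Sum>j=1..i. \<Prod>k=j..<i. S k \<omega>)"
      unfolding D_eq S_def using t l i \<open>s \<le> v\<close>
      by (intro exp_lindley_le[where p = "\<lambda>i. max 0 (- displacement s v (\<lambda>i. X i \<omega>) i)"]
          displacement_Suc_neg_part) (auto simp: displacement_1)
    moreover have "exp (t * l * \<bar>D \<omega>\<bar>) \<le> exp (t * l * max 0 (D \<omega>)) + exp (t * l * max 0 (- D \<omega>))"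
      by (cases "D \<omega> \<ge> 0") auto
    ultimately have e: "exp (t * (l * \<bar>D \<omega>\<bar>)) \<le>
        (\<Sum>j=1..i. \<Prod>k=j..<i. R k \<omega>) + (\<Sum>j=1..i. \<Prod>k=j..<i. S k \<omega>)"
      by (simp add: mult.assoc)
    have "\<bar>D \<omega>\<bar> powr a = l powr (- a) * (l * \<bar>D \<omega>\<bar>) powr a"
      using l by (simp add: powr_mult powr_minus field_simps)
    also have "\<dots> \<le> l powr (- a) * ((a / t) powr a * exp (t * (l * \<bar>D \<omega>\<bar>)))"
      using l a t by (intro mult_left_mono powr_le_exp) auto
    also have "\<dots> \<le> B \<omega>"
      unfolding B_def using mult_left_mono[OF e, of "l powr (- a) * (a / t) powr a"]
      by (simp add: ac_simps)
    finally show ?thesis .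
  qed
  \<comment> \<open>The arrival times are rebuilt from their measurable increments;
    \<open>X 0\<close> is known to vanish on \<open>space M\<close> only, hence the congruence in
    the base case.\<close>
  have Xm: "X k \<in> borel_measurable M" for k
  proof (induction k)
    case 0
    have "X 0 \<in> borel_measurable M \<longleftrightarrow> (\<lambda>_. 0 :: real) \<in> borel_measurable M"
      by (rule measurable_cong) (use X0 in auto)
    then show ?case by simp
  next
    case (Suc k)
    have "(\<lambda>\<omega>. X (Suc k) \<omega> - X k \<omega>) \<in> borel_measurable M"
      using distributed_measurable[OF dist] by simp
    then have "(\<lambda>\<omega>. (X (Suc k) \<omega> - X k \<omega>) + X k \<omega>) \<in> borel_measurable M"
      using Suc by (rule borel_measurable_add)
    then show ?case by simp
  qed
  \<comment> \<open>The clamp recursion expresses each displacement by measurable operations on the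
    previous one.\<close>
  have Dm: "D \<in> borel_measurable M"
    unfolding D_eq using i
  proof (induction i rule: dec_induct)
    case base
    then show ?case by (simp add: displacement_1)
  next
    case (step i)
    note [measurable] = Xm step.IH
    show ?case
      unfolding displacement_Suc[OF step(1) \<open>s \<le> v\<close>] by measurable
  qed
  have Bi: "integrable M B" unfolding B_def using bR(1) bS(1) by auto
  show Di: "integrable M (\<lambda>\<omega>. \<bar>D \<omega>\<bar> powr a)"
  proof (rule Bochner_Integration.integrable_bound[OF Bi])
    show "(\<lambda>\<omega>. \<bar>D \<omega>\<bar> powr a) \<in> borel_measurable M" using Dm by measurable
    show "AE \<omega> in M. norm (\<bar>D \<omega>\<bar> powr a) \<le> norm (B \<omega>)"
      using bound by (auto intro: order_trans[OF _ abs_ge_self])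
  qed
  have "expectation (\<lambda>\<omega>. \<bar>D \<omega>\<bar> powr a) \<le> expectation B"
    using Di Bi bound by (intro integral_mono) auto
  also have "\<dots> = (a / t) powr a * l powr (- a) *
      (expectation (\<lambda>\<omega>. \<Sum>j=1..i. \<Prod>k=j..<i. R k \<omega>) + expectation (\<lambda>\<omega>. \<Sum>j=1..i. \<Prod>k=j..<i. S k \<omega>))"
    unfolding B_def by (simp only: integral_mult_right_zero Bochner_Integration.integral_add[OF bR(1) bS(1)])
  also have "\<dots> \<le> (a / t) powr a * l powr (- a) * (1 / (1 - \<rho>) + 1 / (1 - \<sigma>))"
    using bR(2) bS(2) by (intro mult_left_mono add_mono) auto
  finally show "expectation (\<lambda>\<omega>. \<bar>D \<omega>\<bar> powr a) \<le>
      (a / t) powr a * (1 / (1 - \<rho>) + 1 / (1 - \<sigma>)) * l powr (- a)"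
    by (simp add: ac_simps)
qed

theorem theorem9:
  fixes \<epsilon> \<tau> a :: real
    and M :: "nat \<Rightarrow> 'b measure"
    and X :: "nat \<Rightarrow> nat \<Rightarrow> 'b \<Rightarrow> real"
  assumes "\<epsilon> > 0" and "\<tau> > 0" and "a > 0"
    and "\<And>n. n \<ge> 1 \<Longrightarrow> prob_space (M n)"
    and "\<And>n. n \<ge> 1 \<Longrightarrow> poisson_arrival_times (M n) (real n) (X n)"
  shows "(\<forall>n\<ge>1. integrable (M n)
            (\<lambda>\<omega>. I1_movement a n ((1 - \<epsilon>) / real n) ((1 + \<tau>) / real n) (\<lambda>i. X n i \<omega>))) \<and>
         (\<lambda>n. prob_space.expectation (M n)
            (\<lambda>\<omega>. I1_movement a n ((1 - \<epsilon>) / real n) ((1 + \<tau>) / real n) (\<lambda>i. X n i \<omega>)))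
           \<in> O(\<lambda>n. real n powr (1 - a))"
proof -
  obtain t where t: "0 < t" "t < 1" "exp (t * (1 - \<epsilon>)) / (1 + t) < 1" "exp (- t * (1 + \<tau>)) / (1 - t) < 1"
    using exists_contracting_exponent[OF assms(1,2)] .
  \<comment> \<open>As \<open>t\<close> was chosen from \<open>\<epsilon>\<close> and
    \<open>\<tau>\<close> alone, \<open>C\<close> does not depend on \<open>n\<close>.\<close>
  define C where "C = (a / t) powr a *
    (1 / (1 - exp (t * (1 - \<epsilon>)) / (1 + t)) + 1 / (1 - exp (- t * (1 + \<tau>)) / (1 - t)))"
  define D where "D = (\<lambda>n i \<omega>. displacement ((1 - \<epsilon>) / real n) ((1 + \<tau>) / real n) (\<lambda>i. X n i \<omega>) i)"
  have D: "integrable (M n) (\<lambda>\<omega>. \<bar>D n i \<omega>\<bar> powr a)"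
      "prob_space.expectation (M n) (\<lambda>\<omega>. \<bar>D n i \<omega>\<bar> powr a) \<le> C * real n powr (- a)"
    if "n \<ge> 1" "i \<ge> 1" for n i
    using prob_space.expectation_displacement_le[OF assms(4)[OF that(1)] assms(5)[OF that(1)] _
        assms(1,2) t(1,2) refl t(3) refl t(4) assms(3) that(2)] that(1)
    by (auto simp: D_def C_def)
  have mv: "I1_movement a n ((1 - \<epsilon>) / real n) ((1 + \<tau>) / real n) (\<lambda>i. X n i \<omega>) =
      (\<Sum>i=1..n. \<bar>D n i \<omega>\<bar> powr a)" for n \<omega>
    by (simp add: I1_movement_eq_displacement D_def)
  have "norm (prob_space.expectation (M n) (\<lambda>\<omega>. \<Sum>i=1..n. \<bar>D n i \<omega>\<bar> powr a)) \<le>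
      C * norm (real n powr (1 - a))" if "n \<ge> 1" for n
  proof -
    have "prob_space.expectation (M n) (\<lambda>\<omega>. \<Sum>i=1..n. \<bar>D n i \<omega>\<bar> powr a) =
        (\<Sum>i=1..n. prob_space.expectation (M n) (\<lambda>\<omega>. \<bar>D n i \<omega>\<bar> powr a))"
      using D(1)[OF that] by (intro Bochner_Integration.integral_sum) auto
    also have "\<dots> \<le> (\<Sum>i=1..n. C * real n powr (- a))"
      using D(2)[OF that] by (intro sum_mono) auto
    also have "\<dots> = C * real n powr (1 - a)"
      using that by (simp add: powr_diff powr_minus field_simps)
    finally show ?thesis
      by (simp add: integral_nonneg_AE sum_nonneg)
  qed
  then have "(\<lambda>n. prob_space.expectation (M n) (\<lambda>\<omega>. \<Sum>i=1..n. \<bar>D n i \<omega>\<bar> powr a))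
      \<in> O(\<lambda>n. real n powr (1 - a))"
    \<comment> \<open>The bound starts at \<open>n = 1\<close>, where the probability assumptions
      begin to hold.\<close>
    by (intro bigoI[of _ C]) (auto simp: eventually_at_top_linorder intro!: exI[of _ 1])
  then show ?thesis
    unfolding mv using D(1) by auto
qed

end
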